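(* Let $G$ be a finitely generated group satisfying a law, let $A = G$, let $B$ be a proper subgroup of $G$, let $\phi : G \to B$ be an isomorphism, and let $\Gamma = (G,A,B,t)$ be the (semi-proper) HNN extension relative to $G$, $B$ and $\phi$. Then $\mathrm{girth}(\Gamma) < \infty$.
   Context: HNN extension: for a group $G$, subgroups $A, B \leq G$ and an isomorphism $\phi : A \to B$, the HNN extension of $G$ relative to $A$, $B$ and $\phi$ with stable letter $t$ is $(G,A,B,t) = \langle G, t \mid t^{-1} a t = \phi(a) \text{ for } a \in A\rangle$. It is called semi-proper when one of $A,B$ is a proper subgroup of $G$ and the other equals $G$. A group $G$ satisfies a law if there is a non-trivial element $w(x_1,\dots,x_k)$ of a free group on $x_1,\dots,x_k$ such that $w(g_1,\dots,g_k) = 1$ for all $g_1,\dots,g_k \in G$. Girth: for a finitely generated group $\Gamma$ and a finite generating set $S$ of $\Gamma$, $\mathrm{girth}(\Gamma, S)$ is the length of the shortest non-trivial relation of $\Gamma$ with respect to $S$, i.e. the minimal length of a non-empty freely reduced word in the alphabet $S^{\pm 1}$ which represents the identity of $\Gamma$ (and $\infty$ if there is no such word). Then $\mathrm{girth}(\Gamma) = \sup\{\mathrm{girth}(\Gamma, S) : S \subset \Gamma,\ \langle S\rangle = \Gamma,\ |S| < \infty\}$. *)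

theory Defs
  imports "HOL-Algebra.Generated_Groups" "HOL-Library.Extended_Nat"
begin

text \<open>
  The letter \<open>(x, True)\<close> stands for \<open>x\<close> and \<open>(x, False)\<close> for its formal inverse. The elements of the
  free group on a set \<open>X\<close> are represented by their normal forms, the freely reduced words over \<open>X\<close>;
  the non-trivial ones are the non-empty reduced words.
\<close>

type_synonym 'x word = "('x \<times> bool) list"

definition inv_letter :: "'x \<times> bool \<Rightarrow> 'x \<times> bool" where
  "inv_letter l = (fst l, \<not> snd l)"

definition words :: "'x set \<Rightarrow> 'x word set" where
  "words X = lists (X \<times> UNIV)"

definition reduced :: "'x word \<Rightarrow> bool" where
  "reduced w \<longleftrightarrow> successively (\<lambda>l l'. l' \<noteq> inv_letter l) w"

definition letter_value :: "('a, 'm) monoid_scheme \<Rightarrow> ('x \<Rightarrow> 'a) \<Rightarrow> 'x \<times> bool \<Rightarrow> 'a" where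
  "letter_value G f l = (if snd l then f (fst l) else inv\<^bsub>G\<^esub> f (fst l))"

definition word_value :: "('a, 'm) monoid_scheme \<Rightarrow> ('x \<Rightarrow> 'a) \<Rightarrow> 'x word \<Rightarrow> 'a" where
  "word_value G f w = foldr (\<lambda>l a. letter_value G f l \<otimes>\<^bsub>G\<^esub> a) w \<one>\<^bsub>G\<^esub>"

definition satisfies_law :: "('a, 'm) monoid_scheme \<Rightarrow> bool" where
  "satisfies_law G \<longleftrightarrow>
    (\<exists>(k::nat) w. w \<in> words {..<k} \<and> reduced w \<and> w \<noteq> [] \<and>
      (\<forall>g. (\<forall>i<k. g i \<in> carrier G) \<longrightarrow> word_value G g w = \<one>\<^bsub>G\<^esub>))"

definition finite_generating_set :: "('a, 'm) monoid_scheme \<Rightarrow> 'a set \<Rightarrow> bool" where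
  "finite_generating_set G S \<longleftrightarrow> finite S \<and> S \<subseteq> carrier G \<and> generate G S = carrier G"

definition finitely_generated :: "('a, 'm) monoid_scheme \<Rightarrow> bool" where
  "finitely_generated G \<longleftrightarrow> (\<exists>S. finite_generating_set G S)"

text \<open>
  The alphabet \<open>S\<^sup>\<plusminus>\<close> is formal: relations are non-trivial elements of the free group on \<open>S\<close>, so that,
  for instance, \<open>s s\<close> is a relation of length 2 whenever \<open>s \<in> S\<close> is an involution. The infimum of the
  empty set is \<open>\<infinity>\<close>.
\<close>

definition girth_wrt :: "('a, 'm) monoid_scheme \<Rightarrow> 'a set \<Rightarrow> enat" where
  "girth_wrt G S =
    (INF w \<in> {w \<in> words S. w \<noteq> [] \<and> reduced w \<and> word_value G id w = \<one>\<^bsub>G\<^esub>}. enat (length w))"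

definition girth :: "('a, 'm) monoid_scheme \<Rightarrow> enat" where
  "girth G = (SUP S \<in> {S. finite_generating_set G S}. girth_wrt G S)"

text \<open>
  Two words over \<open>X\<close> represent the same element of the group with generators \<open>X\<close> and relators \<open>R\<close>
  iff they are connected by finitely many insertions and deletions of pairs of mutually inverse letters
  and of relators.
\<close>

inductive pres_eq :: "'x set \<Rightarrow> 'x word set \<Rightarrow> 'x word \<Rightarrow> 'x word \<Rightarrow> bool" for X R where
  pres_refl: "u \<in> words X \<Longrightarrow> pres_eq X R u u"
| pres_sym: "pres_eq X R u v \<Longrightarrow> pres_eq X R v u"
| pres_trans: "pres_eq X R u v \<Longrightarrow> pres_eq X R v w \<Longrightarrow> pres_eq X R u w"
| pres_cancel: "u \<in> words X \<Longrightarrow> v \<in> words X \<Longrightarrow> l \<in> X \<times> UNIV \<Longrightarrow>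
    pres_eq X R (u @ [l, inv_letter l] @ v) (u @ v)"
| pres_relator: "u \<in> words X \<Longrightarrow> v \<in> words X \<Longrightarrow> r \<in> R \<Longrightarrow> r \<in> words X \<Longrightarrow>
    pres_eq X R (u @ r @ v) (u @ v)"

definition pres_rel :: "'x set \<Rightarrow> 'x word set \<Rightarrow> ('x word \<times> 'x word) set" where
  "pres_rel X R = {(u, v). pres_eq X R u v}"

definition presented_group :: "'x set \<Rightarrow> 'x word set \<Rightarrow> 'x word set monoid" where
  "presented_group X R =
    \<lparr>carrier = words X // pres_rel X R,
     mult = (\<lambda>P Q. \<Union>u\<in>P. \<Union>v\<in>Q. pres_rel X R `` {u @ v}),
     one = pres_rel X R `` {[]}\<rparr>"

lemma words_simps [simp]:
  "[] \<in> words X"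
  "l # w \<in> words X \<longleftrightarrow> fst l \<in> X \<and> w \<in> words X"
  "u @ v \<in> words X \<longleftrightarrow> u \<in> words X \<and> v \<in> words X"
  by (auto simp: words_def mem_Times_iff)

lemma pres_eq_words: "pres_eq X R u v \<Longrightarrow> u \<in> words X \<and> v \<in> words X"
  by (induction rule: pres_eq.induct) (auto simp: inv_letter_def)

lemma equiv_pres_rel: "equiv (words X) (pres_rel X R)"
proof (rule equivI)
  show "pres_rel X R \<subseteq> words X \<times> words X"
    by (auto simp: pres_rel_def dest: pres_eq_words)
  show "refl_on (words X) (pres_rel X R)"
    by (simp add: refl_on_def pres_rel_def pres_refl)
  show "sym (pres_rel X R)"
    by (rule symI) (simp add: pres_rel_def pres_sym)
  show "trans (pres_rel X R)"
    by (rule transI) (simp add: pres_rel_def, rule pres_trans)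
qed

lemma pres_eq_append_left:
  "pres_eq X R u v \<Longrightarrow> w \<in> words X \<Longrightarrow> pres_eq X R (w @ u) (w @ v)"
proof (induction rule: pres_eq.induct)
  case (pres_cancel u v l)
  then show ?case using pres_eq.pres_cancel[of "w @ u" X v l R] by simp
next
  case (pres_relator u v r)
  then show ?case using pres_eq.pres_relator[of "w @ u" X v r R] by simp
next
  case (pres_sym u v)
  show ?case
    by (rule pres_eq.pres_sym[OF pres_sym.IH[OF pres_sym.prems]])
next
  case (pres_trans u v w')
  show ?case
    by (rule pres_eq.pres_trans[OF pres_trans.IH(1)[OF pres_trans.prems] pres_trans.IH(2)[OF pres_trans.prems]])
next
  case (pres_refl u)
  then show ?case by (intro pres_eq.pres_refl) simp
qed

lemma pres_eq_append_right:
  "pres_eq X R u v \<Longrightarrow> w \<in> words X \<Longrightarrow> pres_eq X R (u @ w) (v @ w)"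
proof (induction rule: pres_eq.induct)
  case (pres_cancel u v l)
  then show ?case using pres_eq.pres_cancel[of u X "v @ w" l R] by simp
next
  case (pres_relator u v r)
  then show ?case using pres_eq.pres_relator[of u X "v @ w" r R] by simp
next
  case (pres_sym u v)
  show ?case
    by (rule pres_eq.pres_sym[OF pres_sym.IH[OF pres_sym.prems]])
next
  case (pres_trans u v w')
  show ?case
    by (rule pres_eq.pres_trans[OF pres_trans.IH(1)[OF pres_trans.prems] pres_trans.IH(2)[OF pres_trans.prems]])
next
  case (pres_refl u)
  then show ?case by (intro pres_eq.pres_refl) simp
qed

lemma pres_eq_append:
  assumes "pres_eq X R u u'" "pres_eq X R v v'"
  shows "pres_eq X R (u @ v) (u' @ v')"
proof (rule pres_trans)
  show "pres_eq X R (u @ v) (u' @ v)"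
    using assms(1) pres_eq_words[OF assms(2)] by (simp add: pres_eq_append_right)
  show "pres_eq X R (u' @ v) (u' @ v')"
    using assms(2) pres_eq_words[OF assms(1)] by (simp add: pres_eq_append_left)
qed

lemma presented_group_mult:
  assumes "u \<in> words X" "v \<in> words X"
  shows "pres_rel X R `` {u} \<otimes>\<^bsub>presented_group X R\<^esub> pres_rel X R `` {v} = pres_rel X R `` {u @ v}"
proof -
  have "pres_rel X R `` {u' @ v'} = pres_rel X R `` {u @ v}"
    if "u' \<in> pres_rel X R `` {u}" "v' \<in> pres_rel X R `` {v}" for u' v'
    by (rule equiv_class_eq[OF equiv_pres_rel, symmetric])
      (use that in \<open>simp add: pres_rel_def pres_eq_append\<close>)
  moreover have "u \<in> pres_rel X R `` {u}" "v \<in> pres_rel X R `` {v}"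
    by (rule equiv_class_self[OF equiv_pres_rel], fact)+
  ultimately have "(\<Union>u'\<in>pres_rel X R `` {u}. \<Union>v'\<in>pres_rel X R `` {v}. pres_rel X R `` {u' @ v'})
      = pres_rel X R `` {u @ v}"
    by blast
  then show ?thesis
    by (simp add: presented_group_def)
qed

lemma inverse_word_in_words: "w \<in> words X \<Longrightarrow> rev (map inv_letter w) \<in> words X"
  by (induction w) (auto simp: inv_letter_def)

lemma inverse_word_eq_Nil:
  "w \<in> words X \<Longrightarrow> pres_eq X R (rev (map inv_letter w) @ w) []"
proof (induction w)
  case (Cons l w)
  have *: "rev (map inv_letter w) \<in> words X"
    using Cons.prems by (simp add: inverse_word_in_words)
  have "pres_eq X R (rev (map inv_letter w) @ [inv_letter l, inv_letter (inv_letter l)] @ w)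
      (rev (map inv_letter w) @ w)"
    by (rule pres_cancel) (use Cons.prems * in \<open>auto simp: inv_letter_def mem_Times_iff\<close>)
  moreover have "pres_eq X R (rev (map inv_letter w) @ w) []"
    using Cons by simp
  moreover have "inv_letter (inv_letter l) = l"
    by (simp add: inv_letter_def)
  ultimately show ?case
    using pres_trans[of X R _ "rev (map inv_letter w) @ w"] by simp
qed (simp add: pres_refl)

lemma group_presented_group: "group (presented_group X R)"
proof (rule groupI)
  have carrier_iff: "P \<in> carrier (presented_group X R) \<longleftrightarrow> (\<exists>u\<in>words X. P = pres_rel X R `` {u})" for P
    by (auto simp: presented_group_def quotient_def)
  have one: "\<one>\<^bsub>presented_group X R\<^esub> = pres_rel X R `` {[]}"
    by (simp add: presented_group_def)
  show "\<one>\<^bsub>presented_group X R\<^esub> \<in> carrier (presented_group X R)"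
    unfolding carrier_iff one by (rule bexI[of _ "[]"]) auto
  fix P Q T
  assume P: "P \<in> carrier (presented_group X R)"
  then obtain u where u: "u \<in> words X" "P = pres_rel X R `` {u}"
    using carrier_iff by blast
  show "\<one>\<^bsub>presented_group X R\<^esub> \<otimes>\<^bsub>presented_group X R\<^esub> P = P"
    using u by (simp add: one presented_group_mult)
  have "rev (map inv_letter u) \<in> words X"
    using u by (simp add: inverse_word_in_words)
  moreover from this have "pres_rel X R `` {rev (map inv_letter u)} \<otimes>\<^bsub>presented_group X R\<^esub> P
      = \<one>\<^bsub>presented_group X R\<^esub>"
    unfolding u(2) one presented_group_mult[OF \<open>rev (map inv_letter u) \<in> words X\<close> u(1)]
    using inverse_word_eq_Nil[OF u(1), of R]
    by (intro equiv_class_eq[OF equiv_pres_rel]) (simp add: pres_rel_def)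
  ultimately show "\<exists>Q\<in>carrier (presented_group X R).
      Q \<otimes>\<^bsub>presented_group X R\<^esub> P = \<one>\<^bsub>presented_group X R\<^esub>"
    using carrier_iff by blast
  assume Q: "Q \<in> carrier (presented_group X R)"
  then obtain v where v: "v \<in> words X" "Q = pres_rel X R `` {v}"
    using carrier_iff by blast
  show "P \<otimes>\<^bsub>presented_group X R\<^esub> Q \<in> carrier (presented_group X R)"
    unfolding carrier_iff using u v by (intro bexI[of _ "u @ v"]) (auto simp: presented_group_mult)
  assume T: "T \<in> carrier (presented_group X R)"
  then obtain w where w: "w \<in> words X" "T = pres_rel X R `` {w}"
    using carrier_iff by blast
  show "P \<otimes>\<^bsub>presented_group X R\<^esub> Q \<otimes>\<^bsub>presented_group X R\<^esub> T
      = P \<otimes>\<^bsub>presented_group X R\<^esub> (Q \<otimes>\<^bsub>presented_group X R\<^esub> T)"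
    using u v w by (simp add: presented_group_mult)
qed

text \<open>
  \<open>\<langle>G, t | t\<^sup>-\<^sup>1 a t = \<phi> a for a \<in> A\<rangle>\<close>: the generators are the elements of \<open>G\<close> and the stable letter \<open>t\<close>,
  the relators are the multiplication table of \<open>G\<close> and the words \<open>t\<^sup>-\<^sup>1 a t (\<phi> a)\<^sup>-\<^sup>1\<close>. The second
  associated subgroup is \<open>\<phi> ` A\<close> and need not be given separately.
\<close>

datatype 'a hnn_generator = Base 'a | Stable

definition hnn_generators :: "('a, 'm) monoid_scheme \<Rightarrow> 'a hnn_generator set" where
  "hnn_generators G = insert Stable (Base ` carrier G)"

definition hnn_relators ::
  "('a, 'm) monoid_scheme \<Rightarrow> 'a set \<Rightarrow> ('a \<Rightarrow> 'a) \<Rightarrow> 'a hnn_generator word set" where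
  "hnn_relators G A \<phi> =
    {[(Base g, True), (Base h, True), (Base (g \<otimes>\<^bsub>G\<^esub> h), False)] |g h.
        g \<in> carrier G \<and> h \<in> carrier G} \<union>
    {[(Stable, False), (Base a, True), (Stable, True), (Base (\<phi> a), False)] |a. a \<in> A}"

definition hnn_extension ::
  "('a, 'm) monoid_scheme \<Rightarrow> 'a set \<Rightarrow> ('a \<Rightarrow> 'a) \<Rightarrow> 'a hnn_generator word set monoid" where
  "hnn_extension G A \<phi> = presented_group (hnn_generators G) (hnn_relators G A \<phi>)"

end

theory Submission
  imports Defs "HOL-Algebra.Bij"
begin

text \<open>
  Let \<open>N\<close> be the union of the ascending chain \<open>t\<^sup>n G t\<^sup>-\<^sup>n\<close>. As a directed union of copies of \<open>G\<close> it
  satisfies every law of \<open>G\<close>, and it contains all commutators of \<open>\<Gamma>\<close> because \<open>\<Gamma> / N\<close> is generated by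
  \<open>t\<close>. Hence if \<open>w\<close> is a law of \<open>G\<close>, then substituting the commutator of \<open>p\<^sup>i\<^sup>+\<^sup>1\<close> and \<open>q\<close> for the
  \<open>i\<close>-th variable of \<open>w\<close> gives a relation between arbitrary \<open>p, q \<in> \<Gamma>\<close>. It is freely non-trivial, and
  its length depends on \<open>w\<close> only. It bounds the girth with respect to every generating set with
  two distinct elements, and there are no others: \<open>\<Gamma>\<close> is not abelian, since \<open>G\<close> embeds into \<open>\<Gamma>\<close>
  and \<open>t\<^sup>-\<^sup>1 g t = \<phi> g \<noteq> g\<close> for some \<open>g\<close>.
\<close>

section \<open>Evaluation of words in a group\<close>

abbreviation inverse_word :: "'x word \<Rightarrow> 'x word" where
  "inverse_word w \<equiv> rev (map inv_letter w)"

lemma inv_letter_simps [simp]: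
  "inv_letter (x, e) = (x, \<not> e)"
  "inv_letter (inv_letter l) = l"
  by (simp_all add: inv_letter_def)

lemma words_UNIV [simp]: "w \<in> words UNIV"
  by (simp add: words_def)

lemma word_value_Nil [simp]: "word_value G f [] = \<one>\<^bsub>G\<^esub>"
  by (simp add: word_value_def)

lemma word_value_Cons [simp]:
  "word_value G f (l # w) = letter_value G f l \<otimes>\<^bsub>G\<^esub> word_value G f w"
  by (simp add: word_value_def)

context group
begin

lemma letter_value_closed:
  "l \<in> X \<times> UNIV \<Longrightarrow> f \<in> X \<rightarrow> carrier G \<Longrightarrow> letter_value G f l \<in> carrier G"
  by (auto simp: letter_value_def)

lemma letter_value_inv_letter:
  "l \<in> X \<times> UNIV \<Longrightarrow> f \<in> X \<rightarrow> carrier G \<Longrightarrow> letter_value G f (inv_letter l) = inv (letter_value G f l)"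
  by (auto simp: letter_value_def inv_letter_def Pi_iff)

lemma word_value_closed:
  "w \<in> words X \<Longrightarrow> f \<in> X \<rightarrow> carrier G \<Longrightarrow> word_value G f w \<in> carrier G"
  by (induction w) (auto simp: letter_value_closed mem_Times_iff)

lemma word_value_append:
  assumes "f \<in> X \<rightarrow> carrier G" "u \<in> words X" "v \<in> words X"
  shows "word_value G f (u @ v) = word_value G f u \<otimes> word_value G f v"
  using assms
  by (induction u)
    (auto simp: word_value_closed letter_value_closed mem_Times_iff intro!: m_assoc[symmetric])

lemma word_value_inverse_word:
  assumes "f \<in> X \<rightarrow> carrier G" "w \<in> words X"
  shows "word_value G f (inverse_word w) = inv (word_value G f w)"
  using assms(2)
proof (induction w)
  case (Cons l w)
  then have l: "l \<in> X \<times> UNIV" and w: "w \<in> words X"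
    by (auto simp: mem_Times_iff)
  have "[inv_letter l] \<in> words X"
    using l by (auto simp: inv_letter_def)
  then have "word_value G f (inverse_word (l # w))
      = inv (word_value G f w) \<otimes> inv (letter_value G f l)"
    using Cons.IH[OF w] w l assms(1)
    by (simp add: word_value_append[OF assms(1)] inverse_word_in_words letter_value_inv_letter
        letter_value_closed)
  then show ?case
    using w l assms(1) by (simp add: inv_mult_group word_value_closed letter_value_closed)
qed simp

text \<open>Both kinds of elementary move leave the value unchanged. Without relators this says that
  the value depends only on the element of the free group; with the HNN relators it makes a map on
  the generators a representation of the extension.\<close>

lemma word_value_pres_eq:
  assumes "pres_eq X R u v" and f: "f \<in> X \<rightarrow> carrier G"
    and R: "\<And>r. r \<in> R \<Longrightarrow> r \<in> words X \<Longrightarrow> word_value G f r = \<one>"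
  shows "word_value G f u = word_value G f v"
  using assms(1)
proof (induction rule: pres_eq.induct)
  case (pres_cancel u v l)
  then have "[l, inv_letter l] \<in> words X"
    by (auto simp: inv_letter_def)
  moreover have "word_value G f [l, inv_letter l] = \<one>"
    using pres_cancel(3) f by (simp add: letter_value_inv_letter letter_value_closed)
  ultimately show ?case
    using pres_cancel f by (simp add: word_value_append[OF f] word_value_closed del: append_Cons word_value_Cons)
next
  case (pres_relator u v r)
  then show ?case
    using f R by (simp add: word_value_append[OF f] word_value_closed)
qed auto

end

lemma (in group_hom) hom_word_value:
  assumes f: "f \<in> X \<rightarrow> carrier G" and "w \<in> words X"
  shows "h (word_value G f w) = word_value H (\<lambda>x. h (f x)) w"
  using assms(2)
proof (induction w)
  case (Cons l w)
  then have l: "l \<in> X \<times> UNIV" and w: "w \<in> words X"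
    by (auto simp: mem_Times_iff)
  have "h (letter_value G f l) = letter_value H (\<lambda>x. h (f x)) l"
    using l f by (auto simp: letter_value_def Pi_iff)
  then show ?case
    using Cons.IH[OF w] w f G.letter_value_closed[OF l f]
    by (simp add: G.word_value_closed)
qed simp

lemma word_value_cong:
  "w \<in> words X \<Longrightarrow> (\<And>x. x \<in> X \<Longrightarrow> f x = g x) \<Longrightarrow> word_value G f w = word_value G g w"
  by (induction w) (auto simp: word_value_def letter_value_def)

lemma word_value_map:
  "word_value G f (map (\<lambda>l. (h (fst l), snd l)) w) = word_value G (\<lambda>x. f (h x)) w"
  by (induction w) (auto simp: word_value_def letter_value_def)

text \<open>Injectivity keeps letters of different generators from becoming mutually
  inverse.\<close>

lemma reduced_map:
  assumes "inj h" "reduced w"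
  shows "reduced (map (\<lambda>l. (h (fst l), snd l)) w)"
  using assms unfolding reduced_def successively_map
  by (auto simp: inv_letter_def inj_eq prod_eq_iff elim!: successively_mono)

section \<open>Substitution and free reduction in the free group of rank two\<close>

definition subst_word :: "('x \<Rightarrow> 'y word) \<Rightarrow> 'x word \<Rightarrow> 'y word" where
  "subst_word \<sigma> w = concat (map (\<lambda>l. if snd l then \<sigma> (fst l) else inverse_word (\<sigma> (fst l))) w)"

lemma (in group) word_value_subst_word:
  assumes f: "range f \<subseteq> carrier G"
  shows "word_value G f (subst_word \<sigma> w) = word_value G (\<lambda>i. word_value G f (\<sigma> i)) w"
proof -
  have f: "f \<in> UNIV \<rightarrow> carrier G"
    using f by auto
  show ?thesis
    by (induction w)
      (simp_all add: subst_word_def word_value_append[OF f] word_value_inverse_word[OF f] letter_value_def)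
qed

abbreviation free_eq :: "'x word \<Rightarrow> 'x word \<Rightarrow> bool" where
  "free_eq \<equiv> pres_eq UNIV {}"

lemma free_eq_cancel_replicate:
  "free_eq (p @ replicate n l @ replicate n (inv_letter l) @ q) (p @ q)"
proof (induction n)
  case (Suc n)
  have "free_eq ((p @ replicate n l) @ [l, inv_letter l] @ (replicate n (inv_letter l) @ q))
      ((p @ replicate n l) @ (replicate n (inv_letter l) @ q))"
    by (rule pres_cancel) auto
  moreover have "p @ replicate (Suc n) l @ replicate (Suc n) (inv_letter l) @ q
      = (p @ replicate n l) @ [l, inv_letter l] @ (replicate n (inv_letter l) @ q)"
    by (simp add: replicate_app_Cons_same)
  ultimately show ?case
    using Suc by (metis append_assoc pres_trans)
qed (simp add: pres_refl)

text \<open>The alphabet is \<open>bool\<close>: the first component of a letter names one of two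
  generators, the second is its sign.\<close>

abbreviation \<alpha> :: "bool \<times> bool" where "\<alpha> \<equiv> (True, True)"
abbreviation \<alpha>' :: "bool \<times> bool" where "\<alpha>' \<equiv> (True, False)"
abbreviation \<beta> :: "bool \<times> bool" where "\<beta> \<equiv> (False, True)"
abbreviation \<beta>' :: "bool \<times> bool" where "\<beta>' \<equiv> (False, False)"

text \<open>The commutators of \<open>\<alpha>\<^bsup>i + 1\<^esup>\<close> and \<open>\<beta>\<close>, a free family in the free group on \<open>\<alpha>\<close> and \<open>\<beta>\<close>.\<close>

definition comm_word :: "nat \<Rightarrow> bool word" where
  "comm_word i = replicate (Suc i) \<alpha> @ [\<beta>] @ replicate (Suc i) \<alpha>' @ [\<beta>']"

lemma reduced_Cons: "reduced (l # w) \<longleftrightarrow> reduced w \<and> (w \<noteq> [] \<longrightarrow> hd w \<noteq> inv_letter l)"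
  by (cases w) (auto simp: reduced_def)

lemma reduced_replicate_append:
  "reduced (replicate (Suc n) l @ w) \<longleftrightarrow> reduced w \<and> (w \<noteq> [] \<longrightarrow> hd w \<noteq> inv_letter l)"
proof (induction n)
  case (Suc n)
  have "l \<noteq> inv_letter l"
    by (auto simp: inv_letter_def prod_eq_iff)
  then show ?case
    using Suc by (auto simp: reduced_Cons)
qed (simp add: reduced_Cons)

lemma reduced_replicate: "reduced (replicate n l)"
  using reduced_replicate_append[of "n - 1" l "[]"] by (cases n) (auto simp: reduced_def)

text \<open>
  The part of the word substituted for a first letter that survives every cancellation with the
  following factors.
\<close>

definition comm_prefix :: "nat \<times> bool \<Rightarrow> bool word" where
  "comm_prefix l = (if snd l then replicate (Suc (fst l)) \<alpha> @ [\<beta>]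
     else [\<beta>] @ replicate (Suc (fst l)) \<alpha> @ [\<beta>'])"

text \<open>Induction adds factors on the left. Between neighbours of equal sign nothing cancels.
  For opposite signs the indices differ, as \<open>w\<close> is reduced; so, after a possible
  cancellation of \<beta>' with \<beta>, two powers of \<alpha> merge into a non-trivial one, which
  shields the prefix on its left. Since prefixes are non-empty, the substituted word is non-trivial
  in the free group.\<close>

lemma reduced_subst_comm_word:
  assumes "reduced w" "w \<noteq> []"
  shows "\<exists>r. reduced (comm_prefix (hd w) @ r) \<and> free_eq (subst_word comm_word w) (comm_prefix (hd w) @ r)"
  using assms(2,1)
proof (induction w rule: list_nonempty_induct)
  case (single l)
  obtain i e where l: "l = (i, e)" by (cases l)
  show ?case
  proof (cases e)
    case True
    then show ?thesis
      by (intro exI[of _ "replicate (Suc i) \<alpha>' @ [\<beta>']"])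
       (simp add: l comm_prefix_def subst_word_def comm_word_def pres_refl reduced_Cons
          reduced_replicate_append del: replicate_Suc, simp add: reduced_def)
  next
    case False
    then show ?thesis
      by (intro exI[of _ "replicate (Suc i) \<alpha>'"])
        (simp add: l comm_prefix_def subst_word_def comm_word_def pres_refl reduced_Cons
          reduced_replicate reduced_replicate_append del: replicate_Suc)
  qed
next
  case (cons l w)
  obtain i e where l: "l = (i, e)" by (cases l)
  obtain j e' where hd: "hd w = (j, e')" by (cases "hd w")
  let ?A = "\<lambda>n. replicate (Suc n) \<alpha>" and ?A' = "\<lambda>n. replicate (Suc n) \<alpha>'"
  have red: "reduced w" and ne: "(j, e') \<noteq> (i, \<not> e)"
    using cons by (auto simp: reduced_Cons l hd)
  obtain r where r: "reduced (comm_prefix (j, e') @ r)"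
      "free_eq (subst_word comm_word w) (comm_prefix (j, e') @ r)"
    using cons.IH[OF red] hd by auto
  have step: ?case
    if "reduced (comm_prefix (i, e) @ s)"
      "free_eq (subst_word comm_word [l] @ comm_prefix (j, e') @ r) (comm_prefix (i, e) @ s)" for s
  proof -
    have "free_eq (subst_word comm_word (l # w)) (subst_word comm_word [l] @ comm_prefix (j, e') @ r)"
      using pres_eq_append_left[OF r(2), of "subst_word comm_word [l]"] by (simp add: subst_word_def)
    from pres_trans[OF this that(2)] that(1) show ?thesis
      by (auto simp: l)
  qed
  have cancel_b: "free_eq (p @ [\<beta>'] @ [\<beta>] @ q) (p @ q)" for p q
    using pres_cancel[of p UNIV q \<beta>' "{}"] by simp
  \<comment> \<open>What remains of \<open>?A' i @ ?A j\<close> is the power of \<alpha> with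
    exponent \<open>j - i\<close>: \<open>Suc d\<close> is the absolute value and \<open>x\<close>
    carries the sign. That \<open>fst x\<close> holds prevents cancellation with \<beta> or
    \<beta>'.\<close>
  have "\<exists>d x. fst x \<and> (\<forall>p q. free_eq (p @ ?A' i @ ?A j @ q) (p @ replicate (Suc d) x @ q))"
    if "i \<noteq> j"
  proof (cases "i < j")
    case True
    then obtain d where d: "j = i + Suc d"
      using less_imp_Suc_add by auto
    have "?A j = ?A i @ ?A d"
      unfolding d by (simp add: replicate_add[symmetric] add.commute del: replicate_Suc)
    then show ?thesis
      using free_eq_cancel_replicate[of _ "Suc i" \<alpha>'] by (intro exI[of _ d] exI[of _ \<alpha>]) simp
  next
    case False
    then obtain d where d: "i = j + Suc d"
      using less_imp_Suc_add \<open>i \<noteq> j\<close> by (metis add_Suc_right linorder_neqE_nat)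
    have "?A' i = ?A' d @ ?A' j"
      unfolding d by (simp add: replicate_add[symmetric] add.commute del: replicate_Suc)
    then show ?thesis
      using free_eq_cancel_replicate[of "_ @ ?A' d" "Suc j" \<alpha>']
      by (intro exI[of _ d] exI[of _ \<alpha>']) simp
  qed
  then obtain d x where x: "i \<noteq> j \<Longrightarrow> fst x"
      "\<And>p q. i \<noteq> j \<Longrightarrow> free_eq (p @ ?A' i @ ?A j @ q) (p @ replicate (Suc d) x @ q)"
    by metis
  \<comment> \<open>Powers stay folded as \<open>replicate (Suc n)\<close> below, the shape that
    \<open>reduced_replicate_append\<close> matches.\<close>
  have hd_replicate: "hd (replicate (Suc n) x @ q) = x" for n and x :: "bool \<times> bool" and q
    by simp
  note s = hd_replicate comm_prefix_def comm_word_def subst_word_def l reduced_Cons reduced_replicate_append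
  note [simp del] = replicate_Suc
  consider (pp) "e" "e'" | (mm) "\<not> e" "\<not> e'" | (pm) "e" "\<not> e'" | (mp) "\<not> e" "e'"
    by blast
  then show ?case
  proof cases
    case pp
    show ?thesis
      by (rule step[of "?A' i @ [\<beta>'] @ comm_prefix (j, e') @ r"])
        (use pp r(1) in \<open>auto simp: s pres_refl\<close>)
  next
    case mm
    show ?thesis
      by (rule step[of "?A' i @ comm_prefix (j, e') @ r"])
        (use mm r(1) in \<open>auto simp: s pres_refl\<close>)
  next
    case pm
    have "free_eq (subst_word comm_word [l] @ comm_prefix (j, e') @ r)
        (?A i @ [\<beta>] @ ?A' i @ ?A j @ [\<beta>'] @ r)"
      using cancel_b[of "?A i @ [\<beta>] @ ?A' i"] pm by (simp add: s)
    moreover have "i \<noteq> j"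
      using ne pm by auto
    ultimately show ?thesis
      using x(1) x(2)[of "?A i @ [\<beta>]" "[\<beta>'] @ r"] r(1) pm
      by (intro step[of "replicate (Suc d) x @ [\<beta>'] @ r"])
        (auto simp: s inv_letter_def intro: pres_trans)
  next
    case mp
    then have "i \<noteq> j"
      using ne by auto
    then show ?thesis
      using x(1) x(2)[of "[\<beta>] @ ?A i @ [\<beta>']" "[\<beta>] @ r"] r(1) mp
      by (intro step[of "replicate (Suc d) x @ [\<beta>] @ r"])
        (auto simp: s inv_letter_def)
  qed
qed

section \<open>The ascending union of conjugates of the base group\<close>

text \<open>The homomorphism from the free group to the integers that extends \<delta>. With
  \<delta> equal to 1 at the stable letter and 0 elsewhere it is the exponent sum of
  \<open>t\<close>.\<close>

definition word_weight :: "('x \<Rightarrow> int) \<Rightarrow> 'x word \<Rightarrow> int" where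
  "word_weight \<delta> w = (\<Sum>l\<leftarrow>w. if snd l then \<delta> (fst l) else - \<delta> (fst l))"

lemma word_weight_append: "word_weight \<delta> (u @ v) = word_weight \<delta> u + word_weight \<delta> v"
  by (simp add: word_weight_def)

lemma word_weight_inverse_word: "word_weight \<delta> (inverse_word w) = - word_weight \<delta> w"
  by (induction w) (auto simp: word_weight_def inv_letter_def)

text \<open>This isolates what the chain argument takes from the HNN extension;
  \<open>conj_t\<close> is the defining relation solved for the element of the base.\<close>

locale stable_letter = group_hom G H \<iota> for G (structure) and H (structure) and \<iota> +
  fixes \<phi> :: "'a \<Rightarrow> 'a" and t :: 'c
  assumes \<phi>_closed: "g \<in> carrier G \<Longrightarrow> \<phi> g \<in> carrier G"
    and t_closed: "t \<in> carrier H"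
    and conj_t: "g \<in> carrier G \<Longrightarrow> \<iota> g = t \<otimes>\<^bsub>H\<^esub> \<iota> (\<phi> g) \<otimes>\<^bsub>H\<^esub> inv\<^bsub>H\<^esub> t"
begin

primrec lift :: "nat \<Rightarrow> 'a \<Rightarrow> 'c" where
  "lift 0 g = \<iota> g"
| "lift (Suc n) g = t \<otimes>\<^bsub>H\<^esub> lift n g \<otimes>\<^bsub>H\<^esub> inv\<^bsub>H\<^esub> t"

lemma lift_closed: "g \<in> carrier G \<Longrightarrow> lift n g \<in> carrier H"
  by (induction n) (auto simp: t_closed)

lemma t_cancel: "x \<in> carrier H \<Longrightarrow> inv\<^bsub>H\<^esub> t \<otimes>\<^bsub>H\<^esub> (t \<otimes>\<^bsub>H\<^esub> x) = x"
  by (simp add: t_closed H.m_assoc[symmetric])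

lemma lift_hom: "group_hom G H (lift n)"
proof (intro group_hom.intro group_hom_axioms.intro homI)
  show "lift n (g \<otimes> h) = lift n g \<otimes>\<^bsub>H\<^esub> lift n h" if "g \<in> carrier G" "h \<in> carrier G" for g h
    by (induction n) (use that in \<open>simp_all add: t_closed lift_closed H.m_assoc t_cancel\<close>)
qed (auto simp: lift_closed)

text \<open>The relation \<open>conj_t\<close>, conjugated by \<open>t^n\<close>. This is why the
  chain ascends.\<close>

lemma lift_level: "g \<in> carrier G \<Longrightarrow> lift n g = lift (Suc n) (\<phi> g)"
  by (induction n) (simp_all add: conj_t[symmetric])

lemma lift_level_ge:
  assumes "g \<in> carrier G" "n \<le> m"
  shows "\<exists>h\<in>carrier G. lift n g = lift m h"
  using assms(2)
proof (induction m rule: dec_induct)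
  case (step m)
  then show ?case
    using lift_level \<phi>_closed by metis
qed (use assms in auto)

text \<open>The subgroup \<open>N\<close> of the introductory remarks.\<close>

definition ascent :: "'c set" where
  "ascent = (\<Union>n. lift n ` carrier G)"

lemma lift_in_ascent: "g \<in> carrier G \<Longrightarrow> lift n g \<in> ascent"
  by (auto simp: ascent_def)

lemma ascentE:
  assumes "x \<in> ascent"
  obtains n g where "g \<in> carrier G" "x = lift n g"
  using assms unfolding ascent_def by blast

lemma ascent_closed: "x \<in> ascent \<Longrightarrow> x \<in> carrier H"
  by (auto simp: ascent_def lift_closed)

lemma ascent_subgroup: "subgroup ascent H"
proof
  show "x \<otimes>\<^bsub>H\<^esub> y \<in> ascent" if x: "x \<in> ascent" and y: "y \<in> ascent" for x y
  proof -
    from x obtain n g where "g \<in> carrier G" "x = lift n g"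
      by (rule ascentE)
    moreover from y obtain m h where "h \<in> carrier G" "y = lift m h"
      by (rule ascentE)
    ultimately obtain g' h' where "g' \<in> carrier G" "h' \<in> carrier G"
        "x = lift (max n m) g'" "y = lift (max n m) h'"
      using lift_level_ge[of g n "max n m"] lift_level_ge[of h m "max n m"] by auto
    then show ?thesis
      by (simp add: group_hom.hom_mult[OF lift_hom, symmetric] lift_in_ascent)
  qed
  show "\<one>\<^bsub>H\<^esub> \<in> ascent"
    using lift_in_ascent[of \<one> 0] by simp
  show "inv\<^bsub>H\<^esub> x \<in> ascent" if "x \<in> ascent" for x
    using that
    by (elim ascentE) (simp add: group_hom.hom_inv[OF lift_hom, symmetric] lift_in_ascent)
qed (auto simp: ascent_closed)

text \<open>Conjugation by \<open>t\<close> and its inverse moves elements up and down the chain,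
  which makes \<open>ascent\<close> normalized by \<open>t\<close>.\<close>

lemma ascent_conj:
  assumes "x \<in> ascent"
  shows "t \<otimes>\<^bsub>H\<^esub> x \<otimes>\<^bsub>H\<^esub> inv\<^bsub>H\<^esub> t \<in> ascent" "inv\<^bsub>H\<^esub> t \<otimes>\<^bsub>H\<^esub> x \<otimes>\<^bsub>H\<^esub> t \<in> ascent"
proof -
  from assms obtain n g where x: "g \<in> carrier G" "x = lift n g"
    by (rule ascentE)
  then show "t \<otimes>\<^bsub>H\<^esub> x \<otimes>\<^bsub>H\<^esub> inv\<^bsub>H\<^esub> t \<in> ascent"
    using lift_in_ascent[of g "Suc n"] by simp
  \<comment> \<open>At level 0 there is no outer \<open>t\<close> to strip, so \<open>x\<close> is
    first rewritten one level higher.\<close>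
  have "x = t \<otimes>\<^bsub>H\<^esub> lift n (\<phi> g) \<otimes>\<^bsub>H\<^esub> inv\<^bsub>H\<^esub> t"
    using x lift_level[of g n] by simp
  then have "inv\<^bsub>H\<^esub> t \<otimes>\<^bsub>H\<^esub> x \<otimes>\<^bsub>H\<^esub> t = lift n (\<phi> g)"
    using x by (simp add: t_closed lift_closed \<phi>_closed H.m_assoc t_cancel)
  then show "inv\<^bsub>H\<^esub> t \<otimes>\<^bsub>H\<^esub> x \<otimes>\<^bsub>H\<^esub> t \<in> ascent"
    using x by (simp add: lift_in_ascent \<phi>_closed)
qed

text \<open>Modulo \<open>ascent\<close> only powers of \<open>t\<close> remain. They are collected
  on the right, each letter \<open>t\<close> or its inverse conjugating the part in
  \<open>ascent\<close> that it passes.\<close>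

lemma word_value_ascent:
  assumes f: "\<And>x. x \<in> X \<Longrightarrow> (\<delta> x = 0 \<and> f x \<in> ascent) \<or> (\<delta> x = 1 \<and> f x = t)"
    and "w \<in> words X"
  shows "\<exists>m\<in>ascent. word_value H f w = m \<otimes>\<^bsub>H\<^esub> t [^]\<^bsub>H\<^esub> word_weight \<delta> w"
  using assms(2)
proof (induction w)
  case Nil
  show ?case
    using subgroup.one_closed[OF ascent_subgroup]
    by (intro bexI[of _ "\<one>\<^bsub>H\<^esub>"]) (auto simp: word_weight_def)
next
  case (Cons l w)
  then obtain m where m: "m \<in> ascent" "word_value H f w = m \<otimes>\<^bsub>H\<^esub> t [^]\<^bsub>H\<^esub> word_weight \<delta> w"
    by auto
  obtain x e where l: "l = (x, e)" by (cases l)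
  let ?k = "word_weight \<delta> w"
  consider "\<delta> x = 0" "f x \<in> ascent" | "\<delta> x = 1" "f x = t"
    using f[of x] Cons.prems l by auto
  then show ?case
  proof cases
    case 1
    then have "letter_value H f l \<in> ascent"
      using subgroup.m_inv_closed[OF ascent_subgroup] by (auto simp: letter_value_def l)
    moreover have "word_weight \<delta> (l # w) = ?k"
      using 1 by (simp add: word_weight_def l)
    ultimately show ?thesis
      using m subgroup.m_closed[OF ascent_subgroup]
      by (intro bexI[of _ "letter_value H f l \<otimes>\<^bsub>H\<^esub> m"])
       (auto simp: ascent_closed t_closed H.m_assoc)
  next
    case 2
    show ?thesis
    proof (cases e)
      case True
      have "word_weight \<delta> (l # w) = 1 + ?k"
        using 2 True by (simp add: word_weight_def l)
      then have "word_value H f (l # w)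
          = (t \<otimes>\<^bsub>H\<^esub> m \<otimes>\<^bsub>H\<^esub> inv\<^bsub>H\<^esub> t) \<otimes>\<^bsub>H\<^esub> t [^]\<^bsub>H\<^esub> word_weight \<delta> (l # w)"
        using 2 True m
        by (simp add: l letter_value_def ascent_closed t_closed H.m_assoc H.int_pow_mult t_cancel)
      then show ?thesis
        using ascent_conj(1)[OF m(1)] by blast
    next
      case False
      have "?k = 1 + word_weight \<delta> (l # w)"
        using 2 False by (simp add: word_weight_def l)
      then have "word_value H f (l # w)
          = (inv\<^bsub>H\<^esub> t \<otimes>\<^bsub>H\<^esub> m \<otimes>\<^bsub>H\<^esub> t) \<otimes>\<^bsub>H\<^esub> t [^]\<^bsub>H\<^esub> word_weight \<delta> (l # w)"
        using 2 False m
        by (simp add: l letter_value_def ascent_closed t_closed H.m_assoc H.int_pow_mult)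
      then show ?thesis
        using ascent_conj(2)[OF m(1)] by blast
    qed
  qed
qed

text \<open>A commutator has exponent sum 0, so its power of \<open>t\<close> is trivial.\<close>

lemma commutator_in_ascent:
  fixes \<delta> :: "'x \<Rightarrow> int"
  assumes f: "\<And>x. x \<in> X \<Longrightarrow> (\<delta> x = 0 \<and> f x \<in> ascent) \<or> (\<delta> x = 1 \<and> f x = t)"
    and u: "u \<in> words X" and v: "v \<in> words X"
  shows "word_value H f u \<otimes>\<^bsub>H\<^esub> word_value H f v \<otimes>\<^bsub>H\<^esub> inv\<^bsub>H\<^esub> word_value H f u
    \<otimes>\<^bsub>H\<^esub> inv\<^bsub>H\<^esub> word_value H f v \<in> ascent"
proof -
  let ?w = "u @ v @ inverse_word u @ inverse_word v"
  have f': "f \<in> X \<rightarrow> carrier H"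
    using f t_closed ascent_closed by fast
  have "word_weight \<delta> ?w = 0"
    by (simp add: word_weight_append word_weight_inverse_word)
  then have "word_value H f ?w \<in> ascent"
    using word_value_ascent[where f = f and w = ?w, OF f] u v inverse_word_in_words[OF u]
      inverse_word_in_words[OF v]
    by (auto simp: ascent_closed)
  then show ?thesis
    using u v
    by (simp add: H.word_value_append[OF f'] H.word_value_inverse_word[OF f'] inverse_word_in_words
        H.word_value_closed[OF _ f'] H.m_assoc)
qed

text \<open>The finitely many values substituted lie in one common level, a homomorphic image of
  \<open>G\<close>, where the law holds.\<close>

lemma ascent_law:
  fixes k :: nat
  assumes w: "w \<in> words {..<k}"
    and law: "\<And>g. \<forall>i<k. g i \<in> carrier G \<Longrightarrow> word_value G g w = \<one>"
    and c: "\<And>i. i < k \<Longrightarrow> c i \<in> ascent"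
  shows "word_value H c w = \<one>\<^bsub>H\<^esub>"
proof -
  have "\<forall>i. \<exists>n. i < k \<longrightarrow> (\<exists>g\<in>carrier G. c i = lift n g)"
    using c by (metis ascentE)
  then obtain n where n: "\<And>i. i < k \<Longrightarrow> \<exists>g\<in>carrier G. c i = lift (n i) g"
    by metis
  \<comment> \<open>A common upper bound of the levels; the sum makes sense for \<open>k = 0\<close>
    as well.\<close>
  define N where "N = (\<Sum>i<k. n i)"
  have "\<exists>g\<in>carrier G. c i = lift N g" if "i < k" for i
    using n[OF that] lift_level_ge[of _ "n i" N] member_le_sum[of i "{..<k}" n] that
    by (auto simp: N_def)
  then obtain g where g: "\<And>i. i < k \<Longrightarrow> g i \<in> carrier G \<and> c i = lift N (g i)"
    by metis
  have "word_value H c w = word_value H (\<lambda>i. lift N (g i)) w"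
    using g by (intro word_value_cong[OF w]) auto
  also have "\<dots> = lift N (word_value G g w)"
    using g by (intro group_hom.hom_word_value[OF lift_hom _ w, symmetric]) auto
  also have "\<dots> = \<one>\<^bsub>H\<^esub>"
    using law[of g] g group_hom.hom_one[OF lift_hom] by simp
  finally show ?thesis .
qed

end

section \<open>Presented groups and the embedding of the base group\<close>

lemma pres_class_eq_iff:
  assumes "u \<in> words X" "v \<in> words X"
  shows "pres_rel X R `` {u} = pres_rel X R `` {v} \<longleftrightarrow> pres_eq X R u v"
  using eq_equiv_class_iff[OF equiv_pres_rel assms] by (simp add: pres_rel_def)

definition pres_gen :: "'x set \<Rightarrow> 'x word set \<Rightarrow> 'x \<Rightarrow> 'x word set" where
  "pres_gen X R x = pres_rel X R `` {[(x, True)]}"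

lemma pres_class_closed: "u \<in> words X \<Longrightarrow> pres_rel X R `` {u} \<in> carrier (presented_group X R)"
  by (auto simp: presented_group_def quotient_def)

text \<open>Translates between classes of words and products of generators, so that relators become
  equations in the group.\<close>

lemma word_value_pres_gen:
  assumes "u \<in> words X"
  shows "word_value (presented_group X R) (pres_gen X R) u = pres_rel X R `` {u}"
proof -
  interpret group "presented_group X R"
    by (rule group_presented_group)
  have one: "\<one>\<^bsub>presented_group X R\<^esub> = pres_rel X R `` {[]}"
    by (simp add: presented_group_def)
  have inv: "inv\<^bsub>presented_group X R\<^esub> (pres_rel X R `` {[(x, True)]}) = pres_rel X R `` {[(x, False)]}"
    if "x \<in> X" for x
  proof (rule inv_equality)
    have "pres_eq X R [(x, False), (x, True)] []"
      using pres_cancel[of "[]" X "[]" "(x, False)" R] that by simp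
    then show "pres_rel X R `` {[(x, False)]} \<otimes>\<^bsub>presented_group X R\<^esub> pres_rel X R `` {[(x, True)]}
        = \<one>\<^bsub>presented_group X R\<^esub>"
      using that by (simp add: presented_group_mult one pres_class_eq_iff)
  qed (use that in \<open>simp_all add: pres_class_closed\<close>)
  show ?thesis
    using assms
  proof (induction u)
    case (Cons l u)
    then have "letter_value (presented_group X R) (pres_gen X R) l = pres_rel X R `` {[l]}"
      by (cases l) (auto simp: letter_value_def pres_gen_def inv)
    then show ?case
      using Cons presented_group_mult[of "[l]" X u R] by simp
  qed (simp add: one)
qed

lemma carrier_presented_group:
  assumes "x \<in> carrier (presented_group X R)"
  shows "\<exists>u\<in>words X. x = word_value (presented_group X R) (pres_gen X R) u"
proof -
  obtain u where "u \<in> words X" "x = pres_rel X R `` {u}"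
    using assms by (auto simp: presented_group_def quotient_def)
  then show ?thesis
    using word_value_pres_gen by blast
qed

text \<open>
  \<open>G\<close> acts on \<open>carrier G \<times> T\<^sup>\<nat>\<close> by left multiplication on the first factor, where \<open>T\<close> is a
  transversal of the right cosets of \<open>B\<close>. Since every element of \<open>G\<close> is uniquely \<open>\<phi> g \<otimes> z\<close> with
  \<open>z \<in> T\<close>, the map \<open>\<tau> (g, s) = (\<phi> g \<otimes> s 0, s \<circ> Suc)\<close> is a permutation, and \<open>\<tau> \<circ> g = \<phi> g \<circ> \<tau>\<close>; so
  the stable letter can act as the inverse of \<open>\<tau>\<close>.
\<close>

lemma hnn_base_embeds:
  assumes "group G" and B: "subgroup B G"
    and \<phi>: "\<phi> \<in> iso G (G\<lparr>carrier := B\<rparr>)"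
    and xy: "x \<in> carrier G" "y \<in> carrier G"
    and eq: "pres_eq (hnn_generators G) (hnn_relators G (carrier G) \<phi>) [(Base x, True)] [(Base y, True)]"
  shows "x = y"
proof -
  interpret group G by fact
  have \<phi>_B: "\<phi> g \<in> B" if "g \<in> carrier G" for g
    using \<phi> that by (auto simp: iso_def hom_def)
  have \<phi>_mult: "\<phi> (g \<otimes>\<^bsub>G\<^esub> h) = \<phi> g \<otimes>\<^bsub>G\<^esub> \<phi> h" if "g \<in> carrier G" "h \<in> carrier G" for g h
    using \<phi> that by (auto simp: iso_def hom_def)
  have bij: "bij_betw \<phi> (carrier G) B"
    using \<phi> by (auto simp: iso_def)
  have B_closed: "g \<in> carrier G" if "g \<in> B" for g
    using subgroup.mem_carrier[OF B that] .
  define \<psi> where "\<psi> = inv_into (carrier G) \<phi>"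
  have \<psi>: "\<psi> (\<phi> g) = g" if "g \<in> carrier G" for g
    using bij that by (simp add: \<psi>_def bij_betw_inv_into_left)
  have \<phi>\<psi>: "\<phi> (\<psi> g) = g" "\<psi> g \<in> carrier G" if "g \<in> B" for g
    using bij that by (auto simp: \<psi>_def bij_betw_inv_into_right bij_betw_def inv_into_into)
  \<comment> \<open>The choice is made from the coset as a set, so equal cosets receive the same
    representative.\<close>
  define r where "r g = (SOME x. x \<in> B #>\<^bsub>G\<^esub> g)" for g
  have r_in: "r g \<in> B #>\<^bsub>G\<^esub> g" if "g \<in> carrier G" for g
    unfolding r_def using rcos_self[OF that B] by (rule someI)
  have r_closed: "r g \<in> carrier G" if "g \<in> carrier G" for g
    using r_in[OF that] that B_closed by (auto simp: r_coset_def)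
  have r_B: "g \<otimes>\<^bsub>G\<^esub> inv\<^bsub>G\<^esub> r g \<in> B" if g: "g \<in> carrier G" for g
  proof -
    obtain b where b: "b \<in> B" "r g = b \<otimes>\<^bsub>G\<^esub> g"
      using r_in[OF g] by (auto simp: r_coset_def)
    then have "g \<otimes>\<^bsub>G\<^esub> inv\<^bsub>G\<^esub> r g = inv\<^bsub>G\<^esub> b"
      using g B_closed by (simp add: inv_mult_group m_assoc[symmetric])
    then show ?thesis
      using subgroup.m_inv_closed[OF B b(1)] by simp
  qed
  have r_mult: "r (b \<otimes>\<^bsub>G\<^esub> g) = r g" if "b \<in> B" "g \<in> carrier G" for b g
  proof -
    have "b \<otimes>\<^bsub>G\<^esub> g \<in> B #>\<^bsub>G\<^esub> g"
      using that by (auto simp: r_coset_def)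
    then show ?thesis
      unfolding r_def using repr_independence[OF _ that(2) B] by simp
  qed
  define T where "T = r ` carrier G"
  have T_closed: "z \<in> carrier G" if "z \<in> T" for z
    using that r_closed by (auto simp: T_def)
  have r_T: "r z = z" if z: "z \<in> T" for z
  proof -
    obtain h where h: "h \<in> carrier G" "z = r h"
      using z by (auto simp: T_def)
    have "h = (h \<otimes>\<^bsub>G\<^esub> inv\<^bsub>G\<^esub> r h) \<otimes>\<^bsub>G\<^esub> r h"
      using h r_closed by (simp add: m_assoc)
    then show ?thesis
      using r_mult[OF r_B[OF h(1)] r_closed[OF h(1)]] h by simp
  qed
  define S where "S = carrier G \<times> (UNIV \<rightarrow> T :: (nat \<Rightarrow> 'a) set)"
  \<comment> \<open>Restriction to \<open>S\<close> makes the maps extensional, as membership in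
    \<open>BijGroup S\<close> demands.\<close>
  define \<rho> where "\<rho> g = (\<lambda>z\<in>S. (g \<otimes>\<^bsub>G\<^esub> fst z, snd z))" for g
  define \<tau> where "\<tau> = (\<lambda>z\<in>S. (\<phi> (fst z) \<otimes>\<^bsub>G\<^esub> snd z 0, snd z \<circ> Suc))"
  interpret S: group "BijGroup S"
    by (rule group_BijGroup)
  have \<rho>_closed: "\<rho> g \<in> carrier (BijGroup S)" if "g \<in> carrier G" for g
  proof -
    have "bij_betw (\<rho> g) S S"
      by (rule bij_betwI[where g = "\<rho> (inv\<^bsub>G\<^esub> g)"])
        (use that in \<open>auto simp: \<rho>_def S_def m_assoc[symmetric]\<close>)
    then show ?thesis
      by (auto simp: BijGroup_def Bij_def \<rho>_def)
  qed
  have "bij_betw \<tau> S S"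
  \<comment> \<open>The inverse splits \<open>fst z\<close> into an element of \<open>B\<close> and
    a coset representative, pulls the former back along \<phi> and puts the latter in front of the
    sequence.\<close>
  proof (rule bij_betwI[where g = "\<lambda>z. (\<psi> (fst z \<otimes>\<^bsub>G\<^esub> inv\<^bsub>G\<^esub> r (fst z)), case_nat (r (fst z)) (snd z))"])
    show "\<tau> \<in> S \<rightarrow> S"
      by (auto simp: \<tau>_def S_def \<phi>_B B_closed T_closed Pi_iff)
    show "(\<lambda>z. (\<psi> (fst z \<otimes>\<^bsub>G\<^esub> inv\<^bsub>G\<^esub> r (fst z)), case_nat (r (fst z)) (snd z))) \<in> S \<rightarrow> S"
      by (auto simp: S_def \<phi>\<psi> r_B T_def Pi_iff split: nat.split)
    show "(\<psi> (fst (\<tau> z) \<otimes>\<^bsub>G\<^esub> inv\<^bsub>G\<^esub> r (fst (\<tau> z))), case_nat (r (fst (\<tau> z))) (snd (\<tau> z))) = z"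
      if z: "z \<in> S" for z
    proof -
      have *: "fst z \<in> carrier G" "snd z 0 \<in> T"
        using z by (auto simp: S_def)
      then have "r (fst (\<tau> z)) = snd z 0"
        using z by (simp add: \<tau>_def r_mult \<phi>_B r_T T_closed)
      then show ?thesis
        using z * by (auto simp: \<tau>_def \<psi> m_assoc \<phi>_B B_closed T_closed prod_eq_iff fun_eq_iff split: nat.split)
    qed
    show "\<tau> (\<psi> (fst z \<otimes>\<^bsub>G\<^esub> inv\<^bsub>G\<^esub> r (fst z)), case_nat (r (fst z)) (snd z)) = z" if z: "z \<in> S" for z
    proof -
      have "(\<psi> (fst z \<otimes>\<^bsub>G\<^esub> inv\<^bsub>G\<^esub> r (fst z)), case_nat (r (fst z)) (snd z)) \<in> S"
        using z by (auto simp: S_def \<phi>\<psi> r_B T_def Pi_iff split: nat.split)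
      then show ?thesis
        using z by (auto simp: S_def \<tau>_def \<phi>\<psi> r_B r_closed m_assoc fun_eq_iff)
    qed
  qed
  then have \<tau>_closed: "\<tau> \<in> carrier (BijGroup S)"
    by (auto simp: BijGroup_def Bij_def \<tau>_def)
  have mult: "p \<otimes>\<^bsub>BijGroup S\<^esub> q = compose S p q"
    if "p \<in> carrier (BijGroup S)" "q \<in> carrier (BijGroup S)" for p q
    using that by (simp add: BijGroup_def)
  have \<rho>_mult: "\<rho> g \<otimes>\<^bsub>BijGroup S\<^esub> \<rho> h = \<rho> (g \<otimes>\<^bsub>G\<^esub> h)" if "g \<in> carrier G" "h \<in> carrier G" for g h
    using that by (auto simp: mult \<rho>_closed) (auto simp: compose_def \<rho>_def S_def fun_eq_iff m_assoc)
  have \<tau>_\<rho>: "\<tau> \<otimes>\<^bsub>BijGroup S\<^esub> \<rho> g = \<rho> (\<phi> g) \<otimes>\<^bsub>BijGroup S\<^esub> \<tau>" if "g \<in> carrier G" for g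
    using that by (auto simp: mult \<rho>_closed \<tau>_closed \<phi>_B B_closed)
      (auto simp: compose_def \<rho>_def \<tau>_def S_def fun_eq_iff m_assoc \<phi>_mult \<phi>_B B_closed T_closed Pi_iff)
  define f where "f = (\<lambda>x. case x of Base g \<Rightarrow> \<rho> g | Stable \<Rightarrow> inv\<^bsub>BijGroup S\<^esub> \<tau>)"
  have f: "f \<in> hnn_generators G \<rightarrow> carrier (BijGroup S)"
    by (auto simp: f_def hnn_generators_def \<rho>_closed \<tau>_closed)
  have "word_value (BijGroup S) f [(Base x, True)] = word_value (BijGroup S) f [(Base y, True)]"
  proof (rule S.word_value_pres_eq[OF eq f])
    fix w assume "w \<in> hnn_relators G (carrier G) \<phi>"
    then consider g h where "w = [(Base g, True), (Base h, True), (Base (g \<otimes>\<^bsub>G\<^esub> h), False)]"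
        "g \<in> carrier G" "h \<in> carrier G"
      | g where "w = [(Stable, False), (Base g, True), (Stable, True), (Base (\<phi> g), False)]" "g \<in> carrier G"
      by (auto simp: hnn_relators_def)
    then show "word_value (BijGroup S) f w = \<one>\<^bsub>BijGroup S\<^esub>"
    proof cases
      case 1
      then show ?thesis
        by (simp add: letter_value_def f_def \<rho>_closed S.m_assoc[symmetric] \<rho>_mult)
    next
      case 2
      then show ?thesis
        by (simp add: letter_value_def f_def \<rho>_closed \<tau>_closed \<phi>_B B_closed S.m_assoc[symmetric] \<tau>_\<rho>)
         (simp add: \<rho>_closed \<tau>_closed \<phi>_B B_closed S.m_assoc)
    qed
  qed
  then have "\<rho> x = \<rho> y"
    using xy by (simp add: letter_value_def f_def \<rho>_closed)
  \<comment> \<open>At a point with first component \<one>, left multiplication reveals the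
    multiplier; \<open>r \<one>\<close> merely supplies an element of \<open>T\<close>.\<close>
  then have "\<rho> x (\<one>\<^bsub>G\<^esub>, \<lambda>_. r \<one>\<^bsub>G\<^esub>) = \<rho> y (\<one>\<^bsub>G\<^esub>, \<lambda>_. r \<one>\<^bsub>G\<^esub>)"
    by simp
  moreover have "(\<one>\<^bsub>G\<^esub>, \<lambda>_. r \<one>\<^bsub>G\<^esub>) \<in> S"
    by (simp add: S_def T_def)
  ultimately show ?thesis
    using xy by (simp add: \<rho>_def)
qed

section \<open>The bound on the girth\<close>

text \<open>Cyclic groups are abelian. For a non-abelian group this rules out generating sets with
  fewer than two elements, the empty one included.\<close>

lemma (in group) generated_by_one_comm:
  assumes "generate G S = carrier G" and "S \<subseteq> {s}" "S \<subseteq> carrier G"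
    and "x \<in> carrier G" "y \<in> carrier G"
  shows "x \<otimes> y = y \<otimes> x"
proof (cases "S = {}")
  case True
  then have "carrier G = {\<one>}"
    using assms(1) generate_empty by simp
  then show ?thesis
    using assms(4,5) by simp
next
  case False
  then have "S = {s}" "s \<in> carrier G"
    using assms by auto
  then have "carrier G = {s [^] k | k. k \<in> (UNIV :: int set)}"
    using assms(1) generate_pow by simp
  then obtain m n :: int where "x = s [^] m" "y = s [^] n"
    using assms(4,5) by blast
  then show ?thesis
    using \<open>s \<in> carrier G\<close> by (metis int_pow_mult add.commute)
qed

theorem proposition1p2:
  fixes G :: "('a, 'm) monoid_scheme"
    and A B :: "'a set"
    and \<phi> :: "'a \<Rightarrow> 'a"
  assumes "group G"
    and "finitely_generated G"
    and "satisfies_law G"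
    and "A = carrier G"
    and "subgroup B G"
    and "B \<noteq> carrier G"
    and "\<phi> \<in> iso (G\<lparr>carrier := A\<rparr>) (G\<lparr>carrier := B\<rparr>)"
  shows "girth (hnn_extension G A \<phi>) < \<infinity>"
proof -
  interpret G: group G by fact
  let ?X = "hnn_generators G" and ?R = "hnn_relators G (carrier G) \<phi>"
  define \<Gamma> where "\<Gamma> = presented_group ?X ?R"
  interpret \<Gamma>: group \<Gamma>
    unfolding \<Gamma>_def by (rule group_presented_group)
  have \<phi>: "\<phi> \<in> iso G (G\<lparr>carrier := B\<rparr>)"
    using assms by simp
  have bij: "\<phi> ` carrier G = B"
    using \<phi> by (auto simp: iso_def bij_betw_def)
  have \<phi>_closed: "\<phi> g \<in> carrier G" if "g \<in> carrier G" for g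
    using that bij subgroup.subset[OF \<open>subgroup B G\<close>] by auto
  define \<gamma> where "\<gamma> = pres_gen ?X ?R"
  define t where "t = \<gamma> Stable"
  have X: "Stable \<in> ?X" "\<And>g. Base g \<in> ?X \<longleftrightarrow> g \<in> carrier G"
    by (auto simp: hnn_generators_def)
  have \<gamma>_closed: "\<gamma> x \<in> carrier \<Gamma>" if "x \<in> ?X" for x
    using that by (simp add: \<gamma>_def \<Gamma>_def pres_gen_def pres_class_closed)
  then have \<gamma>: "\<gamma> \<in> ?X \<rightarrow> carrier \<Gamma>" and base_closed: "\<And>g. g \<in> carrier G \<Longrightarrow> \<gamma> (Base g) \<in> carrier \<Gamma>"
    and t_closed: "t \<in> carrier \<Gamma>"
    by (auto simp: X t_def)
  have relator: "word_value \<Gamma> \<gamma> r = \<one>\<^bsub>\<Gamma>\<^esub>" if "r \<in> ?R" "r \<in> words ?X" for r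
  proof -
    have "word_value \<Gamma> \<gamma> r = word_value \<Gamma> \<gamma> []"
      using pres_relator[of "[]" ?X "[]" r ?R] that
      by (simp add: \<gamma>_def \<Gamma>_def word_value_pres_gen pres_class_eq_iff del: word_value_Nil)
    then show ?thesis
      by simp
  qed
  interpret stable_letter G \<Gamma> "\<lambda>g. \<gamma> (Base g)" \<phi> t
  proof
    show "(\<lambda>g. \<gamma> (Base g)) \<in> hom G \<Gamma>"
    proof (rule homI)
      fix g h assume g: "g \<in> carrier G" and h: "h \<in> carrier G"
      have "word_value \<Gamma> \<gamma> [(Base g, True), (Base h, True), (Base (g \<otimes>\<^bsub>G\<^esub> h), False)] = \<one>\<^bsub>\<Gamma>\<^esub>"
        by (rule relator) (use g h in \<open>auto simp: hnn_relators_def X\<close>)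
      then show "\<gamma> (Base (g \<otimes>\<^bsub>G\<^esub> h)) = \<gamma> (Base g) \<otimes>\<^bsub>\<Gamma>\<^esub> \<gamma> (Base h)"
        using g h by (simp add: letter_value_def base_closed \<Gamma>.m_assoc[symmetric])
          (metis G.m_closed \<Gamma>.inv_equality \<Gamma>.inv_inv \<Gamma>.inv_closed \<Gamma>.m_closed base_closed)
    qed (simp add: base_closed)
    fix g assume g: "g \<in> carrier G"
    have "word_value \<Gamma> \<gamma> [(Stable, False), (Base g, True), (Stable, True), (Base (\<phi> g), False)] = \<one>\<^bsub>\<Gamma>\<^esub>"
      by (rule relator) (use g in \<open>auto simp: hnn_relators_def X \<phi>_closed\<close>)
    then have "(inv\<^bsub>\<Gamma>\<^esub> t \<otimes>\<^bsub>\<Gamma>\<^esub> \<gamma> (Base g) \<otimes>\<^bsub>\<Gamma>\<^esub> t) \<otimes>\<^bsub>\<Gamma>\<^esub> inv\<^bsub>\<Gamma>\<^esub> \<gamma> (Base (\<phi> g)) = \<one>\<^bsub>\<Gamma>\<^esub>"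
      using g by (simp add: letter_value_def base_closed \<phi>_closed t_closed \<Gamma>.m_assoc flip: t_def)
    then have "inv\<^bsub>\<Gamma>\<^esub> t \<otimes>\<^bsub>\<Gamma>\<^esub> \<gamma> (Base g) \<otimes>\<^bsub>\<Gamma>\<^esub> t = \<gamma> (Base (\<phi> g))"
      by (metis \<Gamma>.inv_equality \<Gamma>.inv_inv \<Gamma>.inv_closed \<Gamma>.m_closed base_closed g \<phi>_closed t_closed)
    then show "\<gamma> (Base g) = t \<otimes>\<^bsub>\<Gamma>\<^esub> \<gamma> (Base (\<phi> g)) \<otimes>\<^bsub>\<Gamma>\<^esub> inv\<^bsub>\<Gamma>\<^esub> t"
      using g by (metis \<Gamma>.inv_solve_left \<Gamma>.inv_solve_right \<Gamma>.m_assoc \<Gamma>.inv_closed \<Gamma>.m_closed base_closed t_closed)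
  qed (use \<phi>_closed t_closed in auto)

  \<comment> \<open>If \<phi> fixed every element of \<open>G\<close>, its image \<open>B\<close>
    would be all of \<open>G\<close>.\<close>
  obtain g where g: "g \<in> carrier G" "\<phi> g \<noteq> g"
    using bij \<open>B \<noteq> carrier G\<close> by force
  have noncomm: "\<gamma> (Base g) \<otimes>\<^bsub>\<Gamma>\<^esub> t \<noteq> t \<otimes>\<^bsub>\<Gamma>\<^esub> \<gamma> (Base g)"
  proof
    assume "\<gamma> (Base g) \<otimes>\<^bsub>\<Gamma>\<^esub> t = t \<otimes>\<^bsub>\<Gamma>\<^esub> \<gamma> (Base g)"
    moreover have "\<gamma> (Base g) \<otimes>\<^bsub>\<Gamma>\<^esub> t = t \<otimes>\<^bsub>\<Gamma>\<^esub> \<gamma> (Base (\<phi> g))"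
      using g conj_t[OF g(1)] by (simp add: base_closed \<phi>_closed t_closed \<Gamma>.m_assoc)
    ultimately have "\<gamma> (Base (\<phi> g)) = \<gamma> (Base g)"
      using g by (simp add: base_closed \<phi>_closed t_closed)
    then have "pres_eq ?X ?R [(Base (\<phi> g), True)] [(Base g, True)]"
      using g \<phi>_closed by (simp add: \<gamma>_def pres_gen_def pres_class_eq_iff X)
    then show False
      using hnn_base_embeds[OF \<open>group G\<close> \<open>subgroup B G\<close> \<phi>] g \<phi>_closed by blast
  qed

  have base_in_ascent: "\<gamma> (Base g) \<in> ascent" if "g \<in> carrier G" for g
    using lift_in_ascent[OF that, of 0] by simp
  obtain k :: nat and w where w: "w \<in> words {..<k}" "reduced w" "w \<noteq> []"
    and law: "\<And>g. \<forall>i<k. g i \<in> carrier G \<Longrightarrow> word_value G g w = \<one>\<^bsub>G\<^esub>"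
    using \<open>satisfies_law G\<close> unfolding satisfies_law_def by blast
  \<comment> \<open>The word \<open>u\<close> is fixed before any generating set is chosen, so the
    bound on the girth is uniform.\<close>
  obtain u where u: "reduced u" "u \<noteq> []" "free_eq (subst_word comm_word w) u"
    using reduced_subst_comm_word[OF w(2,3)] by (force simp: comm_prefix_def split: if_splits)
  have "girth_wrt \<Gamma> S \<le> enat (length u)" if S: "finite_generating_set \<Gamma> S" for S
  proof -
    have S_closed: "S \<subseteq> carrier \<Gamma>" and gen: "generate \<Gamma> S = carrier \<Gamma>"
      using S by (auto simp: finite_generating_set_def)
    have "\<not> S \<subseteq> {s}" for s
      using \<Gamma>.generated_by_one_comm[OF gen _ S_closed base_closed[OF g(1)] t_closed] noncomm by blast
    then obtain p q where pq: "p \<in> S" "q \<in> S" "p \<noteq> q"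
      by blast
    \<comment> \<open>The two letters go to distinct generators, so relabelling turns
      \<open>u\<close> into a reduced word over \<open>S\<close>.\<close>
    define h where "h c = (if c then p else q)" for c
    have h: "range h \<subseteq> carrier \<Gamma>" "inj h" "range h \<subseteq> S"
      using pq S_closed by (auto simp: h_def inj_def)
    then have h': "h \<in> UNIV \<rightarrow> carrier \<Gamma>"
      by auto
    let ?u = "map (\<lambda>l. (h (fst l), snd l)) u"
    have "word_value \<Gamma> h (comm_word i) \<in> ascent" for i
    proof -
      have x: "word_value \<Gamma> h v \<in> carrier \<Gamma>" for v
        using \<Gamma>.word_value_closed[OF words_UNIV h'] .
      \<comment> \<open>The generators in \<open>S\<close> are arbitrary elements; exponent sums of
        \<open>t\<close> become available only after rewriting in base elements and
        \<open>t\<close>.\<close>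
      then obtain v1 v2 where v: "v1 \<in> words ?X" "v2 \<in> words ?X"
          "word_value \<Gamma> h (replicate (Suc i) \<alpha>) = word_value \<Gamma> \<gamma> v1"
          "word_value \<Gamma> h [\<beta>] = word_value \<Gamma> \<gamma> v2"
        unfolding \<Gamma>_def \<gamma>_def using carrier_presented_group by metis
      have "comm_word i = replicate (Suc i) \<alpha> @ [\<beta>] @ inverse_word (replicate (Suc i) \<alpha>) @ inverse_word [\<beta>]"
        by (simp add: comm_word_def del: replicate_Suc)
      then have "word_value \<Gamma> h (comm_word i)
          = word_value \<Gamma> \<gamma> v1 \<otimes>\<^bsub>\<Gamma>\<^esub> word_value \<Gamma> \<gamma> v2 \<otimes>\<^bsub>\<Gamma>\<^esub> inv\<^bsub>\<Gamma>\<^esub> word_value \<Gamma> \<gamma> v1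
            \<otimes>\<^bsub>\<Gamma>\<^esub> inv\<^bsub>\<Gamma>\<^esub> word_value \<Gamma> \<gamma> v2"
        using v x
        by (simp only: \<Gamma>.word_value_append[OF h'] \<Gamma>.word_value_inverse_word[OF h'] words_UNIV
            \<Gamma>.m_assoc \<Gamma>.inv_closed \<Gamma>.m_closed \<Gamma>.word_value_closed[OF _ \<gamma>])
      also have "\<dots> \<in> ascent"
      proof (rule commutator_in_ascent[where X = ?X and \<delta> = "\<lambda>x. if x = Stable then 1 else 0"])
        show "((if x = Stable then 1 else 0) = (0::int) \<and> \<gamma> x \<in> ascent)
            \<or> ((if x = Stable then 1 else 0) = (1::int) \<and> \<gamma> x = t)" if "x \<in> ?X" for x
          using that base_in_ascent by (auto simp: hnn_generators_def t_def)
      qed (use v in auto)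
      finally show ?thesis .
    qed
    then have "word_value \<Gamma> (\<lambda>i. word_value \<Gamma> h (comm_word i)) w = \<one>\<^bsub>\<Gamma>\<^esub>"
      by (intro ascent_law[OF w(1) law]) auto
    then have "word_value \<Gamma> id ?u = \<one>\<^bsub>\<Gamma>\<^esub>"
      using \<Gamma>.word_value_pres_eq[OF u(3) h'] by (simp add: \<Gamma>.word_value_subst_word[OF h(1)] word_value_map)
    moreover have "?u \<in> words S"
      using h(3) by (auto simp: words_def image_subset_iff)
    moreover have "reduced ?u"
      using h(2) u(1) by (rule reduced_map)
    ultimately show ?thesis
      unfolding girth_wrt_def using u(2)
      by (intro INF_lower2[of ?u]) auto
  qed
  then have "girth \<Gamma> \<le> enat (length u)"
    unfolding girth_def by (intro SUP_least) auto
  also have "\<dots> < \<infinity>"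
    by simp
  finally have "girth \<Gamma> < \<infinity>" .
  then show ?thesis
    using \<open>A = carrier G\<close> by (simp only: hnn_extension_def \<Gamma>_def)
qed

end
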